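(* Let $X\in S_n$ be $k$-increasing (i.e. $X$ avoids the pattern $(k,k-1,\dots,1)$) or $k$-decreasing (i.e. $X$ avoids $(1,2,\dots,k)$). Then for an arbitrary initial tree $T$, the cost of \textsc{Greedy} satisfies $|\textsc{Greedy}_T(X)|\le n\,2^{O(k^2)}$.
   Context: $X$ contains $\pi\in S_k$ if some length-$k$ subsequence of $X$ is order-isomorphic to $\pi$; otherwise $X$ avoids $\pi$. Geometric BST model: $X=(x_1,\dots,x_n)$ is identified with access points $\{(x_t,t)\}$ (key, time). $\square_{pq}$ is the closed axis-parallel rectangle with corners $p,q$. An initial tree $T$ (BST on $[n]$ of depth $d$, root depth 1) is represented by the points $(x,s)$, $s=1-d,\dots,1-d(x)$, for each key $x$ of depth $d(x)$. \textsc{Greedy}: let $\tau(b,t)$ be the largest time $\le t$ at which column $b$ contains a point of $T$ or of the output so far (undefined if none). At time $t$ with access $(a,t)$, add $(a,t)$ and $(b,t)$ for each key $b\ne a$ with $\tau(b,t-1)$ defined such that $\square_{(a,t),(b,\tau(b,t-1))}$ contains no point of $T\cup\{$output points at times $<t\}$ other than $(b,\tau(b,t-1))$. The cost is $|\textsc{Greedy}_T(X)|$, the number of output points. *)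

theory Defs
  imports
    Complex_Main
    "HOL-Library.Tree"
    "HOL-Library.Sublist"
    "HOL-Library.Landau_Symbols"
    "HOL-Combinatorics.Multiset_Permutations"
begin

text \<open>
  A permutation in \<open>S\<^sub>n\<close> is given in one-line notation, as a list in
  \<^term>\<open>permutations_of_set {1..n}\<close>.
\<close>

definition order_isomorphic :: "nat list \<Rightarrow> nat list \<Rightarrow> bool" where
  "order_isomorphic xs ys \<longleftrightarrow>
     length xs = length ys \<and>
     (\<forall>i<length xs. \<forall>j<length xs. xs ! i < xs ! j \<longleftrightarrow> ys ! i < ys ! j)"

definition contains_pattern :: "nat list \<Rightarrow> nat list \<Rightarrow> bool" where
  "contains_pattern X p \<longleftrightarrow> (\<exists>Y. subseq Y X \<and> order_isomorphic Y p)"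

definition avoids_pattern :: "nat list \<Rightarrow> nat list \<Rightarrow> bool" where
  "avoids_pattern X p \<longleftrightarrow> \<not> contains_pattern X p"

definition k_increasing :: "nat \<Rightarrow> nat list \<Rightarrow> bool" where
  "k_increasing k X \<longleftrightarrow> avoids_pattern X (rev [1..<Suc k])"

definition k_decreasing :: "nat \<Rightarrow> nat list \<Rightarrow> bool" where
  "k_decreasing k X \<longleftrightarrow> avoids_pattern X [1..<Suc k]"

definition bst_on :: "nat \<Rightarrow> nat tree \<Rightarrow> bool" where
  "bst_on n T \<longleftrightarrow> bst T \<and> set_tree T = {1..n}"

text \<open>
  The depth of a key along its search path, with the root at depth 1, so that
  \<^const>\<open>height\<close> is the maximal depth of a key. Only meaningful for keys of a search tree.
\<close>

fun key_depth :: "nat tree \<Rightarrow> nat \<Rightarrow> nat" where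
  "key_depth Leaf x = 0"
| "key_depth (Node l a r) x =
     (if x = a then 1 else if x < a then 1 + key_depth l x else 1 + key_depth r x)"

text \<open>
  Points are pairs (key, time). Initial tree points have times at most 0;
  the accesses take place at times \<open>1, \<dots>, n\<close>.
\<close>

type_synonym point = "nat \<times> int"

definition tree_points :: "nat tree \<Rightarrow> point set" where
  "tree_points T =
     {(x, s). x \<in> set_tree T \<and> 1 - int (height T) \<le> s \<and> s \<le> 1 - int (key_depth T x)}"

definition rectangle :: "point \<Rightarrow> point \<Rightarrow> point set" where
  "rectangle p q =
     {min (fst p) (fst q)..max (fst p) (fst q)} \<times> {min (snd p) (snd q)..max (snd p) (snd q)}"

definition last_time :: "point set \<Rightarrow> nat \<Rightarrow> int \<Rightarrow> int option" where
  "last_time P b t =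
     (if \<exists>s\<le>t. (b, s) \<in> P then Some (Max {s. s \<le> t \<and> (b, s) \<in> P}) else None)"

text \<open>
  The points added at time \<open>t\<close> on an access to \<open>a\<close>, where \<open>P\<close> consists of the initial tree
  points and all output points at earlier times.
\<close>

definition greedy_step :: "point set \<Rightarrow> nat \<Rightarrow> int \<Rightarrow> point set" where
  "greedy_step P a t =
     {(a, t)} \<union>
     {(b, t) |b. b \<noteq> a \<and>
        (\<exists>\<tau>. last_time P b (t - 1) = Some \<tau> \<and> rectangle (a, t) (b, \<tau>) \<inter> P \<subseteq> {(b, \<tau>)})}"

text \<open>List indices start at 0, so the access at time \<open>Suc t\<close> is \<open>X ! t\<close>.\<close>

primrec greedy_upto :: "nat tree \<Rightarrow> nat list \<Rightarrow> nat \<Rightarrow> point set" where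
  "greedy_upto T X 0 = {}"
| "greedy_upto T X (Suc t) =
     greedy_upto T X t \<union>
     greedy_step (tree_points T \<union> greedy_upto T X t) (X ! t) (int (Suc t))"

definition greedy :: "nat tree \<Rightarrow> nat list \<Rightarrow> point set" where
  "greedy T X = greedy_upto T X (length X)"

text \<open>The cost of a finite set of output points is its cardinality, so finiteness matters.\<close>

lemma finite_tree_points: "finite (tree_points T)"
proof (rule finite_subset)
  show "tree_points T \<subseteq> set_tree T \<times> {1 - int (height T)..1}"
    unfolding tree_points_def by auto
qed simp

lemma finite_greedy_step:
  assumes "finite P"
  shows "finite (greedy_step P a t)"
proof (rule finite_subset)
  show "greedy_step P a t \<subseteq> insert (a, t) ((\<lambda>b. (b, t)) ` fst ` P)"
    unfolding greedy_step_def last_time_def by (force split: if_splits)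
qed (use assms in simp)

lemma finite_greedy_upto: "finite (greedy_upto T X t)"
  by (induction t) (auto intro: finite_greedy_step finite_tree_points)

lemma finite_greedy: "finite (greedy T X)"
  unfolding greedy_def by (rule finite_greedy_upto)

end

theory Submission
  imports Defs
begin

text \<open>
  Suppose that the output of Greedy contains an increasing chain of \<open>k + 1\<close> points whose bounding
  box contains no access. Then the columns of the chain are touched by accesses to the right of the
  box, which form a decreasing sequence of length \<open>k\<close>; symmetrically for decreasing chains. If
  the access sequence avoids the decreasing pattern of length \<open>k\<close>, every such box therefore
  captures an access. An interval minor of the output that is a full grid of side \<open>k (k + 1)\<close>
  splits into \<open>k \<times> k\<close> grids of side \<open>k + 1\<close>, each of which captures an access, and those on
  the antidiagonal form the avoided pattern. So the output has no such minor, and the bound of Fox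
  gives at most \<open>n 2\<^bsup>O(k\<^sup>2)\<^esup>\<close> points.
\<close>

section \<open>Grid minors\<close>

text \<open>
  The fibres of the monotone labellings are the intervals of columns and rows that are merged.
\<close>

definition grid_minor :: "nat \<Rightarrow> nat \<Rightarrow> ('a::order \<times> 'b::order) set \<Rightarrow> bool" where
  "grid_minor K L A \<longleftrightarrow>
     (\<exists>\<phi> \<psi>. mono \<phi> \<and> mono \<psi> \<and> {..<K} \<times> {..<L} \<subseteq> map_prod \<phi> \<psi> ` A)"

lemma grid_minorI:
  assumes "mono \<phi>" "mono \<psi>"
    and "\<And>i j. i < K \<Longrightarrow> j < L \<Longrightarrow> \<exists>x y. (x, y) \<in> A \<and> \<phi> x = i \<and> \<psi> y = j"
  shows "grid_minor K L A"
  unfolding grid_minor_def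
proof (intro exI conjI subsetI)
  fix z assume "z \<in> {..<K} \<times> {..<L}"
  then obtain i j where z: "z = (i, j)" "i < K" "j < L" by auto
  then obtain x y where "(x, y) \<in> A" "\<phi> x = i" "\<psi> y = j" using assms(3) by blast
  then show "z \<in> map_prod \<phi> \<psi> ` A" using z by force
qed (use assms in auto)

lemma grid_minorE:
  assumes "grid_minor K L A"
  obtains \<phi> \<psi> where "mono \<phi>" "mono \<psi>"
    and "\<And>i j. i < K \<Longrightarrow> j < L \<Longrightarrow> \<exists>x y. (x, y) \<in> A \<and> \<phi> x = i \<and> \<psi> y = j"
proof -
  obtain \<phi> \<psi> where *: "mono \<phi>" "mono \<psi>" "{..<K} \<times> {..<L} \<subseteq> map_prod \<phi> \<psi> ` A"
    using assms unfolding grid_minor_def by blast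
  have "\<exists>x y. (x, y) \<in> A \<and> \<phi> x = i \<and> \<psi> y = j" if "i < K" "j < L" for i j
  proof -
    have "(i, j) \<in> map_prod \<phi> \<psi> ` A" using *(3) that by auto
    then show ?thesis by auto
  qed
  then show thesis using that * by blast
qed

text \<open>Labellings of the coarsened set pull back along \<open>f\<close> and \<open>g\<close>.
  This carries the absence of a minor from a set to its set of nonempty blocks.\<close>

lemma grid_minor_image:
  assumes "mono f" "mono g" "grid_minor K L (map_prod f g ` A)"
  shows "grid_minor K L A"
proof -
  obtain \<phi> \<psi> where *: "mono \<phi>" "mono \<psi>"
      "\<And>i j. i < K \<Longrightarrow> j < L \<Longrightarrow> \<exists>x y. (x, y) \<in> map_prod f g ` A \<and> \<phi> x = i \<and> \<psi> y = j"
    using grid_minorE[OF assms(3)] by metis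
  show ?thesis
  proof (rule grid_minorI)
    show "mono (\<phi> \<circ> f)" "mono (\<psi> \<circ> g)"
      using * assms(1,2) by (auto simp: mono_def)
    fix i j assume "i < K" "j < L"
    then show "\<exists>x y. (x, y) \<in> A \<and> (\<phi> \<circ> f) x = i \<and> (\<psi> \<circ> g) y = j"
      using *(3)[of i j] by auto
  qed
qed

lemma grid_minor_mono:
  assumes "grid_minor K L A" "A \<subseteq> B"
  shows "grid_minor K L B"
  using assms unfolding grid_minor_def by (meson image_mono order_trans)

lemma grid_minor_swap:
  assumes "grid_minor K L (prod.swap ` A)"
  shows "grid_minor L K A"
proof -
  obtain \<phi> \<psi> where *: "mono \<phi>" "mono \<psi>"
      "\<And>i j. i < K \<Longrightarrow> j < L \<Longrightarrow> \<exists>x y. (x, y) \<in> prod.swap ` A \<and> \<phi> x = i \<and> \<psi> y = j"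
    using grid_minorE[OF assms] by metis
  show ?thesis
  proof (rule grid_minorI[OF *(2,1)])
    fix i j assume "i < L" "j < K"
    then show "\<exists>x y. (x, y) \<in> A \<and> \<psi> x = i \<and> \<phi> y = j"
      using *(3)[of j i] by fastforce
  qed
qed

section \<open>Grid minors in a strip of columns with many rows\<close>

lemma rank_labels:
  fixes Y :: "nat set"
  assumes "finite Y"
  shows "\<exists>\<psi>. mono \<psi> \<and> (\<forall>j<card Y. \<exists>y\<in>Y. \<psi> y = j)"
proof (intro exI conjI)
  \<comment> \<open>The rank in \<open>Y\<close> makes sense for every number, so it is monotone
    beyond \<open>Y\<close> as well.\<close>
  let ?\<psi> = "\<lambda>y. card {z \<in> Y. z < y}"
  show "mono ?\<psi>"
    by (intro monoI card_mono) (use assms in auto)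
  have "inj_on ?\<psi> Y"
  proof (rule linorder_inj_onI)
    fix x y assume "x < y" "x \<in> Y" "y \<in> Y"
    then have "{z \<in> Y. z < x} \<subset> {z \<in> Y. z < y}" by auto
    then have "?\<psi> x < ?\<psi> y"
      by (rule psubset_card_mono[rotated]) (use assms in simp)
    then show "?\<psi> x \<noteq> ?\<psi> y" by simp
  qed auto
  then have "card (?\<psi> ` Y) = card {..<card Y}" by (simp add: card_image)
  moreover have "?\<psi> ` Y \<subseteq> {..<card Y}"
    by (auto intro!: psubset_card_mono assms)
  ultimately have "?\<psi> ` Y = {..<card Y}"
    by (metis card_subset_eq finite_lessThan)
  then have "j \<in> ?\<psi> ` Y" if "j < card Y" for j using that by simp
  then show "\<forall>j<card Y. \<exists>y\<in>Y. ?\<psi> y = j" by blast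
qed

text \<open>Once all columns are merged into one, only the rows remain to be separated, by rank.
  This serves as the base of the halving argument.\<close>

lemma grid_minor_one_column:
  fixes B :: "('a::order \<times> nat) set"
  assumes "finite Y" "K \<le> card Y" and row: "\<And>y. y \<in> Y \<Longrightarrow> \<exists>x. (x, y) \<in> B"
  shows "grid_minor (Suc 0) K B"
proof -
  obtain \<psi> where \<psi>: "mono \<psi>" "\<forall>j<card Y. \<exists>y\<in>Y. \<psi> y = j"
    using rank_labels \<open>finite Y\<close> by blast
  show ?thesis
  proof (rule grid_minorI[of "\<lambda>_. 0", OF _ \<psi>(1)])
    fix i j assume "i < Suc 0" "j < K"
    then have "j < card Y" using assms(2) by linarith
    then obtain y where "y \<in> Y" "\<psi> y = j" using \<psi>(2) by blast
    then show "\<exists>x y. (x, y) \<in> B \<and> 0 = i \<and> \<psi> y = j"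
      using row \<open>i < Suc 0\<close> by blast
  qed (auto simp: mono_def)
qed

text \<open>
  Halving the strip: a row keeps all its points in one half, or it has at least half of them in
  one half and a further point in the other half; the latter contributes one more column to a
  minor found in the first half.
\<close>

lemma grid_minor_strip:
  fixes B :: "(nat \<times> nat) set"
  assumes "finite Y" "K * 4 ^ h \<le> card Y" "K > 0"
    and "\<And>y. y \<in> Y \<Longrightarrow> 2 ^ l \<le> card {x \<in> {u..<u + 2 ^ h}. (x, y) \<in> B}"
  shows "grid_minor (Suc l) K (B \<inter> {u..<u + 2 ^ h} \<times> Y)"
proof -
  have row_ne: "S \<noteq> {}" if "2 ^ l \<le> card S" for S :: "nat set" and l
    using that by force
  have halves: "2 * d \<le> card L \<or> 2 * d \<le> card R \<or>
      (d \<le> card L \<and> R \<noteq> {}) \<or> (d \<le> card R \<and> L \<noteq> {})"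
    if "2 * d \<le> card L + card R" for d and L R :: "nat set"
    by (cases "L = {}"; cases "R = {}") (use that in auto)
  from assms show ?thesis
  proof (induction h arbitrary: l u Y)
    case 0
    obtain y where y: "y \<in> Y" using "0.prems"(2,3) by (cases "Y = {}") auto
    \<comment> \<open>A strip of width 1 has at most one point per row, which forces
      \<open>l = 0\<close>.\<close>
    have "card {x \<in> {u..<u + 2 ^ 0}. (x, y) \<in> B} \<le> card {u}"
      by (rule card_mono) auto
    with "0.prems"(4)[OF y] have "(2::nat) ^ l \<le> 1" by simp
    then have "l = 0" using power_gt_expt[of 2 l] by linarith
    have "grid_minor (Suc 0) K (B \<inter> {u..<u + 2 ^ 0} \<times> Y)"
      by (rule grid_minor_one_column[OF \<open>finite Y\<close>])
         (use "0.prems"(2) row_ne[OF "0.prems"(4)] in auto)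
    then show ?case using \<open>l = 0\<close> by simp
  next
    case (Suc h)
    define m where "m = u + 2 ^ h"
    let ?L = "\<lambda>y. {x \<in> {u..<u + 2 ^ h}. (x, y) \<in> B}"
    let ?R = "\<lambda>y. {x \<in> {m..<m + 2 ^ h}. (x, y) \<in> B}"
    have split: "{x \<in> {u..<u + 2 ^ Suc h}. (x, y) \<in> B} = ?L y \<union> ?R y" for y
      by (auto simp: m_def)
    have count: "2 ^ l \<le> card (?L y) + card (?R y)" if "y \<in> Y" for y
      using Suc.prems(4)[OF that] card_Un_le[of "?L y" "?R y"] unfolding split by linarith
    show ?case
    proof (cases l)
      case 0
      have "K \<le> card Y"
        using Suc.prems(2) by (metis le_trans mult.right_neutral mult_le_mono2 one_le_numeral one_le_power)
      then have "grid_minor (Suc 0) K (B \<inter> {u..<u + 2 ^ Suc h} \<times> Y)"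
        by (rule grid_minor_one_column[OF \<open>finite Y\<close>]) (use row_ne[OF Suc.prems(4)] in auto)
      then show ?thesis using 0 by simp
    next
      case (Suc l')
      define Y1 where "Y1 = {y \<in> Y. 2 ^ l \<le> card (?L y)}"
      define Y2 where "Y2 = {y \<in> Y. 2 ^ l \<le> card (?R y)}"
      define Y3 where "Y3 = {y \<in> Y. 2 ^ l' \<le> card (?L y) \<and> ?R y \<noteq> {}}"
      define Y4 where "Y4 = {y \<in> Y. 2 ^ l' \<le> card (?R y) \<and> ?L y \<noteq> {}}"
      note Y_defs = Y1_def Y2_def Y3_def Y4_def
      have fin: "finite Y1" "finite Y2" "finite Y3" "finite Y4"
        using \<open>finite Y\<close> by (auto simp: Y_defs)
      have "y \<in> Y1 \<union> Y2 \<union> Y3 \<union> Y4" if "y \<in> Y" for y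
      proof -
        have "2 * 2 ^ l' \<le> card (?L y) + card (?R y)" using count[OF that] Suc by simp
        from halves[OF this] show ?thesis
          using that Suc unfolding Y_defs by (simp only: Un_iff mem_Collect_eq power_Suc) blast
      qed
      then have "card Y \<le> card (Y1 \<union> Y2 \<union> Y3 \<union> Y4)" using fin by (intro card_mono) auto
      also have "\<dots> \<le> card Y1 + card Y2 + card Y3 + card Y4"
        by (meson add_le_mono1 card_Un_le order_trans)
      \<comment> \<open>Four classes cover the rows, so one of them keeps a quarter; the factor
        \<open>4 ^ h\<close> pays for \<open>h\<close> halvings.\<close>
      finally have "4 * (K * 4 ^ h) \<le> card Y1 + card Y2 + card Y3 + card Y4"
        using Suc.prems(2) by simp
      then consider "K * 4 ^ h \<le> card Y1" | "K * 4 ^ h \<le> card Y2"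
        | "K * 4 ^ h \<le> card Y3" | "K * 4 ^ h \<le> card Y4" by linarith
      then show ?thesis
      proof cases
        case 1
        have "grid_minor (Suc l) K (B \<inter> {u..<u + 2 ^ h} \<times> Y1)"
          by (rule Suc.IH[OF fin(1) 1 \<open>K > 0\<close>]) (simp add: Y1_def)
        then show ?thesis by (rule grid_minor_mono) (auto simp: Y1_def)
      next
        case 2
        have "grid_minor (Suc l) K (B \<inter> {m..<m + 2 ^ h} \<times> Y2)"
          by (rule Suc.IH[OF fin(2) 2 \<open>K > 0\<close>]) (simp add: Y2_def)
        then show ?thesis by (rule grid_minor_mono) (auto simp: Y2_def m_def)
      next
        case 3
        have "grid_minor (Suc l') K (B \<inter> {u..<u + 2 ^ h} \<times> Y3)"
          by (rule Suc.IH[OF fin(3) 3 \<open>K > 0\<close>]) (simp add: Y3_def)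
        from grid_minorE[OF this] obtain \<phi> \<psi> where *: "mono \<phi>" "mono \<psi>"
            "\<And>i j. i < Suc l' \<Longrightarrow> j < K \<Longrightarrow>
               \<exists>x y. (x, y) \<in> B \<inter> {u..<u + 2 ^ h} \<times> Y3 \<and> \<phi> x = i \<and> \<psi> y = j"
          by metis
        \<comment> \<open>Columns left of \<open>m\<close> may carry labels above \<open>l'\<close>.
          The cap keeps them below \<open>l = Suc l'\<close>, the label of the right half, without
          losing any of the labels up to \<open>l'\<close>.\<close>
        define \<phi>' where "\<phi>' x = (if x < m then min (\<phi> x) l' else l)" for x
        show ?thesis
        proof (rule grid_minorI[OF _ *(2)])
          show "mono \<phi>'"
            using monoD[OF *(1)] Suc by (auto simp: mono_def \<phi>'_def intro: min.mono min.coboundedI1)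
          fix i j assume ij: "i < Suc l" "j < K"
          show "\<exists>x y. (x, y) \<in> B \<inter> {u..<u + 2 ^ Suc h} \<times> Y \<and> \<phi>' x = i \<and> \<psi> y = j"
          proof (cases "i = l")
            case True
            obtain y where y: "y \<in> Y3" "\<psi> y = j" using *(3)[of 0 j] ij by auto
            then obtain x where "x \<in> ?R y" unfolding Y3_def by blast
            then show ?thesis using y True unfolding Y3_def \<phi>'_def m_def
              by (intro exI[of _ x] exI[of _ y]) auto
          next
            case False
            then obtain x y where "(x, y) \<in> B \<inter> {u..<u + 2 ^ h} \<times> Y3" "\<phi> x = i" "\<psi> y = j"
              using *(3)[of i j] ij Suc by auto
            then show ?thesis using False ij Suc unfolding Y3_def \<phi>'_def m_def
              by (intro exI[of _ x] exI[of _ y]) auto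
          qed
        qed
      next
        case 4
        have "grid_minor (Suc l') K (B \<inter> {m..<m + 2 ^ h} \<times> Y4)"
          by (rule Suc.IH[OF fin(4) 4 \<open>K > 0\<close>]) (simp add: Y4_def)
        from grid_minorE[OF this] obtain \<phi> \<psi> where *: "mono \<phi>" "mono \<psi>"
            "\<And>i j. i < Suc l' \<Longrightarrow> j < K \<Longrightarrow>
               \<exists>x y. (x, y) \<in> B \<inter> {m..<m + 2 ^ h} \<times> Y4 \<and> \<phi> x = i \<and> \<psi> y = j"
          by metis
        \<comment> \<open>Now the left half is the extra column and comes first, so the labels found
          on the right move up by one.\<close>
        define \<phi>' where "\<phi>' x = (if x < m then 0 else Suc (\<phi> x))" for x
        show ?thesis
        proof (rule grid_minorI[OF _ *(2)])
          show "mono \<phi>'"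
            using monoD[OF *(1)] by (auto simp: mono_def \<phi>'_def)
          fix i j assume ij: "i < Suc l" "j < K"
          show "\<exists>x y. (x, y) \<in> B \<inter> {u..<u + 2 ^ Suc h} \<times> Y \<and> \<phi>' x = i \<and> \<psi> y = j"
          proof (cases i)
            case 0
            obtain y where y: "y \<in> Y4" "\<psi> y = j" using *(3)[of 0 j] ij by auto
            then obtain x where "x \<in> ?L y" unfolding Y4_def by blast
            then show ?thesis using y 0 unfolding Y4_def \<phi>'_def m_def
              by (intro exI[of _ x] exI[of _ y]) auto
          next
            case (Suc i')
            then obtain x y where "(x, y) \<in> B \<inter> {m..<m + 2 ^ h} \<times> Y4" "\<phi> x = i'" "\<psi> y = j"
              using *(3)[of i' j] ij \<open>l = Suc l'\<close> by auto
            then show ?thesis using Suc unfolding Y4_def \<phi>'_def m_def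
              by (intro exI[of _ x] exI[of _ y]) auto
          qed
        qed
      qed
    qed
  qed
qed

text \<open>In \<open>B\<close> only the rows are merged into blocks, while the columns inside the
  block column \<open>X\<close>, of width \<open>2 ^ h\<close>, stay separate. There
  \<open>grid_minor_strip\<close> applies with \<open>l = K - 1\<close>, which explains the
  threshold \<open>2 ^ (K - 1)\<close>.\<close>

lemma grid_minor_wide_blocks:
  fixes A :: "(nat \<times> nat) set"
  assumes "finite Y" "K * 4 ^ h \<le> card Y" "K > 0"
    and wide: "\<And>y. y \<in> Y \<Longrightarrow>
      2 ^ (K - 1) \<le> card {x. x div 2 ^ h = X \<and> (\<exists>z. (x, z) \<in> A \<and> z div 2 ^ h = y)}"
  shows "grid_minor K K A"
proof -
  define B where "B = map_prod id (\<lambda>z. z div 2 ^ h) ` A"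
  have div_iff: "x div 2 ^ h = X \<longleftrightarrow> x \<in> {X * 2 ^ h..<X * 2 ^ h + 2 ^ h}" for x :: nat
  proof
    assume "x div 2 ^ h = X"
    then show "x \<in> {X * 2 ^ h..<X * 2 ^ h + 2 ^ h}"
      using div_mult_mod_eq[of x "2 ^ h"] mod_less_divisor[of "2 ^ h" x]
      unfolding atLeastLessThan_iff by (metis le_add1 nat_add_left_cancel_less zero_less_numeral zero_less_power)
  next
    assume "x \<in> {X * 2 ^ h..<X * 2 ^ h + 2 ^ h}"
    then show "x div 2 ^ h = X" by (intro div_nat_eqI) (auto simp: mult.commute)
  qed
  have "{x. x div 2 ^ h = X \<and> (\<exists>z. (x, z) \<in> A \<and> z div 2 ^ h = y)} =
      {x \<in> {X * 2 ^ h..<X * 2 ^ h + 2 ^ h}. (x, y) \<in> B}" for y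
    unfolding div_iff B_def by force
  then have "grid_minor (Suc (K - 1)) K (B \<inter> {X * 2 ^ h..<X * 2 ^ h + 2 ^ h} \<times> Y)"
    using wide by (intro grid_minor_strip assms) simp_all
  then have "grid_minor K K B" using \<open>K > 0\<close> by (auto intro: grid_minor_mono)
  then show ?thesis
    unfolding B_def by (rule grid_minor_image[rotated 2]) (auto simp: mono_def div_le_mono)
qed

text \<open>A block column with \<open>K * 4 ^ h\<close> wide blocks would already yield the minor,
  and there are \<open>N\<close> block columns.\<close>

lemma card_wide_blocks:
  fixes A :: "(nat \<times> nat) set"
  assumes "finite A" "fst ` A \<subseteq> {..<N * 2 ^ h}" "K > 0" "\<not> grid_minor K K A"
  shows "card {(X, Y) \<in> map_prod (\<lambda>x. x div 2 ^ h) (\<lambda>y. y div 2 ^ h) ` A.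
      2 ^ (K - 1) \<le> card {x. x div 2 ^ h = X \<and> (\<exists>y. (x, y) \<in> A \<and> y div 2 ^ h = Y)}}
    \<le> N * (K * 4 ^ h)" (is "card ?W \<le> _")
proof -
  have fin: "finite ?W"
    by (rule finite_subset[of _ "map_prod (\<lambda>x. x div 2 ^ h) (\<lambda>y. y div 2 ^ h) ` A"])
       (use assms(1) in auto)
  have fin': "finite {Y. (X, Y) \<in> ?W}" for X
    by (rule finite_subset[of _ "snd ` ?W"]) (use fin in force)+
  have slice: "card {Y. (X, Y) \<in> ?W} \<le> K * 4 ^ h" for X
  proof (rule ccontr)
    assume "\<not> ?thesis"
    then have "grid_minor K K A"
      by (intro grid_minor_wide_blocks[OF fin'[of X] _ \<open>K > 0\<close>, of h X]) auto
    then show False using assms(4) by blast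
  qed
  have "?W \<subseteq> Sigma {..<N} (\<lambda>X. {Y. (X, Y) \<in> ?W})"
    using assms(2) by (fastforce simp: less_mult_imp_div_less)
  then have "card ?W \<le> card (Sigma {..<N} (\<lambda>X. {Y. (X, Y) \<in> ?W}))"
    by (intro card_mono finite_SigmaI fin') auto
  also have "\<dots> = (\<Sum>X<N. card {Y. (X, Y) \<in> ?W})"
    by (rule card_SigmaI) (use fin' in auto)
  also have "\<dots> \<le> (\<Sum>X<N. K * 4 ^ h)"
    by (rule sum_mono) (rule slice)
  finally show ?thesis by simp
qed

section \<open>The Marcus--Tardos recursion\<close>

lemma card_block_index_le:
  fixes t X :: nat
  assumes "t > 0"
  shows "card {x. x div t = X \<and> P x} \<le> t" "finite {x. x div t = X \<and> P x}"
proof -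
  have sub: "{x. x div t = X \<and> P x} \<subseteq> {X * t..<X * t + t}"
  proof
    fix x assume "x \<in> {x. x div t = X \<and> P x}"
    then have "x = X * t + x mod t" by (auto simp: div_mult_mod_eq)
    then show "x \<in> {X * t..<X * t + t}"
      using mod_less_divisor[OF assms, of x] by (metis atLeastLessThan_iff le_add1 nat_add_left_cancel_less)
  qed
  show "finite {x. x div t = X \<and> P x}"
    using finite_subset[OF sub] by simp
  show "card {x. x div t = X \<and> P x} \<le> t"
    using card_mono[OF _ sub] by simp
qed

text \<open>
  The Marcus--Tardos recursion: wide and tall blocks are few, every other nonempty block has at
  most a quarter of its side length many points, and the nonempty blocks again form a set without
  the minor.
\<close>

lemma card_no_grid_minor_power:
  fixes A :: "(nat \<times> nat) set"
  assumes "K > 0" "\<not> grid_minor K K A"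
    and "A \<subseteq> {..<(2 ^ (2 * K)) ^ e} \<times> {..<(2 ^ (2 * K)) ^ e}"
  shows "card A \<le> 3 * (K * 4 ^ (2 * K)) * 2 ^ (2 * K) * (2 ^ (2 * K)) ^ e"
  using assms(2,3)
proof (induction e arbitrary: A)
  case 0
  then have "A \<subseteq> {(0, 0)}" by auto
  then have "card A \<le> 1" using card_mono[of "{(0::nat, 0::nat)}" A] by simp
  also have "1 \<le> 3 * (K * 4 ^ (2 * K)) * 2 ^ (2 * K) * (2 ^ (2 * K)) ^ 0"
    using \<open>K > 0\<close> by (simp add: Suc_leI)
  finally show ?case .
next
  case (Suc e)
  \<comment> \<open>This choice makes the side length \<open>t = 4 * (s * s)\<close>, where
    \<open>s\<close> is the threshold for wide and tall blocks. A block that is neither has at most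
    \<open>s * s\<close> points, a quarter of \<open>t\<close>.\<close>
  define h where "h = 2 * K"
  define t :: nat where "t = 2 ^ h"
  define N where "N = t ^ e"
  define s :: nat where "s = 2 ^ (K - 1)"
  define F where "F = K * 4 ^ h"
  define q where "q x = x div t" for x
  define cols where "cols p = {x. q x = fst p \<and> (\<exists>y. (x, y) \<in> A \<and> q y = snd p)}" for p
  define rows where "rows p = {y. q y = snd p \<and> (\<exists>x. (x, y) \<in> A \<and> q x = fst p)}" for p
  define A' where "A' = map_prod q q ` A"
  define W where "W = {p \<in> A'. s \<le> card (cols p)}"
  define V where "V = {p \<in> A'. s \<le> card (rows p)}"
  have "h = 2 + ((K - 1) + (K - 1))" using \<open>K > 0\<close> by (simp add: h_def)
  then have t: "t > 0" "4 * (s * s) = t"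
    by (simp_all add: t_def s_def power_add)
  have A: "A \<subseteq> {..<N * t} \<times> {..<N * t}"
    using Suc.prems(2) by (simp add: N_def t_def h_def mult.commute)
  then have finA: "finite A" by (rule finite_subset) auto
  have mono_q: "mono q" by (auto simp: mono_def q_def div_le_mono)
  have A': "\<not> grid_minor K K A'"
    using grid_minor_image[OF mono_q mono_q] Suc.prems(1) unfolding A'_def by blast
  have "A' \<subseteq> {..<N} \<times> {..<N}"
    using A unfolding A'_def q_def by (force simp: less_mult_imp_div_less)
  then have IH: "card A' \<le> 3 * F * t * N"
    using Suc.IH[OF A'] by (simp add: N_def t_def h_def F_def)
  have W: "card W \<le> N * F"
  proof -
    have "W = {(X, Y) \<in> map_prod (\<lambda>x. x div 2 ^ h) (\<lambda>y. y div 2 ^ h) ` A.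
      2 ^ (K - 1) \<le> card {x. x div 2 ^ h = X \<and> (\<exists>y. (x, y) \<in> A \<and> y div 2 ^ h = Y)}}"
      unfolding W_def A'_def cols_def q_def s_def t_def by auto
    then show ?thesis
      using card_wide_blocks[OF finA _ \<open>K > 0\<close> Suc.prems(1), of N h] A
      unfolding F_def t_def by force
  qed
  have V: "card V \<le> N * F"
  proof -
    \<comment> \<open>Tall blocks of \<open>A\<close> are the wide blocks of its transpose.\<close>
    let ?S = "prod.swap ` A"
    let ?V = "{(Y, X) \<in> map_prod (\<lambda>x. x div 2 ^ h) (\<lambda>y. y div 2 ^ h) ` ?S.
      2 ^ (K - 1) \<le> card {y. y div 2 ^ h = Y \<and> (\<exists>x. (y, x) \<in> ?S \<and> x div 2 ^ h = X)}}"
    have S: "(y, x) \<in> ?S \<longleftrightarrow> (x, y) \<in> A" for x y by force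
    have "prod.swap ` V = ?V"
    proof (intro set_eqI, clarify)
      fix Y X
      have "(Y, X) \<in> prod.swap ` V \<longleftrightarrow> (X, Y) \<in> V" by force
      also have "\<dots> \<longleftrightarrow> (Y, X) \<in> ?V"
        unfolding V_def A'_def rows_def q_def s_def t_def S by force
      finally show "(Y, X) \<in> prod.swap ` V \<longleftrightarrow> (Y, X) \<in> ?V" .
    qed
    moreover have "card (prod.swap ` V) = card V"
      by (intro card_image) (auto simp: inj_on_def)
    moreover have "\<not> grid_minor K K ?S"
      using grid_minor_swap Suc.prems(1) by blast
    moreover have "fst ` ?S \<subseteq> {..<N * 2 ^ h}" using A by (force simp: t_def)
    ultimately show ?thesis
      using card_wide_blocks[of ?S N h K] finA \<open>K > 0\<close> unfolding F_def by simp
  qed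
  have fin: "finite A'" "finite W" "finite V" using finA by (auto simp: A'_def W_def V_def)
  define Z where "Z p = A \<inter> cols p \<times> rows p" for p
  have fin_cr: "finite (cols p)" "finite (rows p)" and le_t: "card (cols p) \<le> t" "card (rows p) \<le> t" for p
    unfolding cols_def rows_def q_def using card_block_index_le[OF t(1)] by auto
  have Z: "card (Z p) \<le> card (cols p) * card (rows p)" for p
    unfolding Z_def card_cartesian_product[symmetric] by (intro card_mono) (use fin_cr in auto)
  have Z_le: "card (Z p) \<le> s * s + (if p \<in> W \<union> V then t * t else 0)" if "p \<in> A'" for p
  proof (cases "p \<in> W \<union> V")
    case True
    then show ?thesis using Z[of p] mult_le_mono[OF le_t[of p]] by simp
  next
    case False
    then have "card (cols p) \<le> s" "card (rows p) \<le> s"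
      using that by (auto simp: W_def V_def)
    then show ?thesis using Z[of p] mult_le_mono False by fastforce
  qed
  have "A \<subseteq> (\<Union>p\<in>A'. Z p)"
    unfolding A'_def Z_def cols_def rows_def by force
  then have "card A \<le> card (\<Union>p\<in>A'. Z p)"
    by (intro card_mono) (use fin finA in \<open>auto simp: Z_def\<close>)
  also have "\<dots> \<le> (\<Sum>p\<in>A'. card (Z p))" by (rule card_UN_le[OF fin(1)])
  also have "\<dots> \<le> (\<Sum>p\<in>A'. s * s + (if p \<in> W \<union> V then t * t else 0))"
    by (rule sum_mono) (rule Z_le)
  also have "\<dots> = card A' * (s * s) + card (W \<union> V) * (t * t)"
  proof -
    have "(\<Sum>p\<in>A'. if p \<in> W \<union> V then t * t else 0) = (\<Sum>p\<in>A' \<inter> (W \<union> V). t * t)"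
      by (rule sum.inter_restrict[OF fin(1), symmetric])
    also have "A' \<inter> (W \<union> V) = W \<union> V" by (auto simp: W_def V_def)
    finally show ?thesis unfolding sum.distrib by simp
  qed
  also have "\<dots> \<le> (3 * F * t * N) * (s * s) + (N * F + N * F) * (t * t)"
    using card_Un_le[of W V] W V by (intro add_mono mult_right_mono IH) linarith+
  \<comment> \<open>The factor 4 turns \<open>s * s\<close> into \<open>t\<close>. In units of
    \<open>N * F * t * t\<close> the sum is then 3 + 8 = 11, while the claim allows 4 * 3 = 12; this
    is where the constant 3 comes from.\<close>
  finally have "4 * card A \<le> 4 * ((3 * F * t * N) * (s * s) + (N * F + N * F) * (t * t))"
    by simp
  also have "\<dots> = (3 * F * t * N) * (4 * (s * s)) + 8 * (N * F * t * t)" by (simp add: algebra_simps)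
  also have "\<dots> = 11 * (N * F * t * t)" unfolding t(2) by (simp add: algebra_simps)
  also have "\<dots> \<le> 4 * (3 * F * t * (t * N))" by (simp add: algebra_simps)
  finally have "card A \<le> 3 * F * t * (t * N)" by linarith
  then show ?case by (simp add: N_def t_def h_def F_def)
qed

text \<open>The recursion works in squares whose side is a power of \<open>t\<close>; passing to the
  smallest such square containing the given one costs at most a factor \<open>t\<close>.\<close>

theorem card_no_grid_minor:
  fixes A :: "(nat \<times> nat) set"
  assumes "K > 0" "\<not> grid_minor K K A" "A \<subseteq> {..<n} \<times> {..<n}"
  shows "card A \<le> 2 ^ (10 * K) * n"
proof (cases "n = 0")
  case True
  then show ?thesis using assms(3) by simp
next
  case False
  define t :: nat where "t = 2 ^ (2 * K)"
  have t: "t \<ge> 2" using \<open>K > 0\<close> by (cases K) (auto simp: t_def)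
  have "\<exists>e. n \<le> t ^ e"
    using power_gt_expt[of t n] t by (intro exI[of _ n]) auto
  define e where "e = (LEAST e. n \<le> t ^ e)"
  have e: "n \<le> t ^ e" unfolding e_def by (rule LeastI_ex) fact
  have te: "t ^ e \<le> t * n"
  proof (cases e)
    case 0
    then show ?thesis using t False by simp
  next
    case (Suc e')
    then have "\<not> n \<le> t ^ e'" using not_less_Least[of e' "\<lambda>e. n \<le> t ^ e"] by (simp add: e_def)
    then show ?thesis using Suc by simp
  qed
  have "A \<subseteq> {..<t ^ e} \<times> {..<t ^ e}" using assms(3) e by force
  then have "card A \<le> 3 * (K * 4 ^ (2 * K)) * t * t ^ e"
    using card_no_grid_minor_power[OF assms(1,2), of e] unfolding t_def by simp
  also have "\<dots> \<le> 3 * (K * 4 ^ (2 * K)) * t * (t * n)" using te by (intro mult_left_mono) auto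
  also have "\<dots> = (3 * K) * (4 ^ (4 * K) * n)"
    unfolding t_def by (simp add: power_mult flip: power_mult_distrib)
  \<comment> \<open>The remaining linear factor is absorbed to give
    \<open>4 ^ (5 * K) = 2 ^ (10 * K)\<close> in total.\<close>
  also have "3 * K \<le> 4 ^ K"
  proof (induction K)
    case (Suc K)
    have "(1::nat) \<le> 4 ^ K" by simp
    moreover have "3 * Suc K \<le> 4 * x" if "3 * K \<le> x" "1 \<le> x" for x :: nat
      using that by presburger
    ultimately show ?case using Suc unfolding power_Suc by blast
  qed simp
  then have "(3 * K) * (4 ^ (4 * K) * n) \<le> 4 ^ K * (4 ^ (4 * K) * n)" by (rule mult_right_mono) simp
  also have "\<dots> = 2 ^ (10 * K) * n"
    by (simp add: power_mult flip: power_mult_distrib)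
  finally show ?thesis .
qed

section \<open>Monotone chains in the output of Greedy\<close>

lemma ex_first_int_between:
  fixes P :: "int \<Rightarrow> bool"
  assumes "P t" "s < t"
  shows "\<exists>t'>s. t' \<le> t \<and> P t' \<and> (\<forall>r. s < r \<longrightarrow> r < t' \<longrightarrow> \<not> P r)"
proof -
  let ?S = "{t'. s < t' \<and> t' \<le> t \<and> P t'}"
  have fin: "finite ?S" by (rule finite_subset[of _ "{s..t}"]) auto
  have "?S \<noteq> {}" using assms by auto
  with fin have "Min ?S \<in> ?S" by (rule Min_in)
  moreover have "Min ?S \<le> r" if "s < r" "r \<le> t" "P r" for r
    using Min_le[OF fin] that by auto
  ultimately show ?thesis by (intro exI[of _ "Min ?S"]) force
qed

lemma div_less_div_imp_less: "a < b" if "a div k < b div k" for a b k :: nat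
  using that div_le_mono leD leI by metis

text \<open>
  The order on the keys is a parameter because the argument is also applied to the reversed order.
\<close>

locale greedy_history = linorder less_eq less
  for less_eq :: "'a \<Rightarrow> 'a \<Rightarrow> bool" (infix "\<sqsubseteq>" 50) and less (infix "\<sqsubset>" 50) +
  fixes G :: "('a \<times> int) set" and acc :: "int \<Rightarrow> 'a"
  assumes access: "(b, t) \<in> G \<Longrightarrow> (acc t, t) \<in> G"
    and touch: "(b, t) \<in> G \<Longrightarrow> (c, s) \<in> G \<Longrightarrow> s < t \<Longrightarrow> c \<noteq> b \<Longrightarrow>
      acc t \<sqsubseteq> c \<and> c \<sqsubseteq> b \<or> b \<sqsubseteq> c \<and> c \<sqsubseteq> acc t \<Longrightarrow> \<exists>s'>s. s' < t \<and> (b, s') \<in> G"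
begin

text \<open>Let \<open>t'\<close> be the first time after \<open>s\<close> at which \<open>b\<close>
  is touched. A key touched at time \<open>s\<close> between \<open>b\<close> and the access at
  \<open>t'\<close> would, by \<open>touch\<close>, force a still earlier one.\<close>

lemma first_touch:
  assumes "(b, t) \<in> G" "s < t"
  obtains t' where "s < t'" "t' \<le> t" "(b, t') \<in> G"
    and "\<And>c. (c, s) \<in> G \<Longrightarrow> c \<noteq> b \<Longrightarrow> \<not> (acc t' \<sqsubseteq> c \<and> c \<sqsubseteq> b) \<and> \<not> (b \<sqsubseteq> c \<and> c \<sqsubseteq> acc t')"
proof -
  obtain t' where t': "s < t'" "t' \<le> t" "(b, t') \<in> G"
    and first: "\<And>r. s < r \<Longrightarrow> r < t' \<Longrightarrow> (b, r) \<notin> G"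
    using ex_first_int_between[of "\<lambda>t. (b, t) \<in> G", OF assms] by blast
  show thesis
  proof (rule that[OF t'])
    fix c assume "(c, s) \<in> G" "c \<noteq> b"
    then show "\<not> (acc t' \<sqsubseteq> c \<and> c \<sqsubseteq> b) \<and> \<not> (b \<sqsubseteq> c \<and> c \<sqsubseteq> acc t')"
      using touch[of b t' c s] t' first by blast
  qed
qed

text \<open>
  Going up an increasing chain, each new column is first touched by an access to the right of the
  box, and to the left of the previous such access.
\<close>

lemma descent_of_uncaptured_chain:
  fixes x :: "nat \<Rightarrow> 'a" and u :: "nat \<Rightarrow> int"
  assumes G: "\<And>i. i \<le> k \<Longrightarrow> (x i, u i) \<in> G"
    and chain: "\<And>i j. i < j \<Longrightarrow> j \<le> k \<Longrightarrow> x i \<sqsubset> x j \<and> u i < u j"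
    and box: "\<And>t. (acc t, t) \<in> G \<Longrightarrow> u 0 \<le> t \<Longrightarrow> t \<le> u k \<Longrightarrow> \<not> (x 0 \<sqsubseteq> acc t \<and> acc t \<sqsubseteq> x k)"
  shows "\<exists>\<tau>. (\<forall>i<k. (acc (\<tau> i), \<tau> i) \<in> G) \<and>
    (\<forall>i j. i < j \<longrightarrow> j < k \<longrightarrow> \<tau> i < \<tau> j \<and> acc (\<tau> j) \<sqsubset> acc (\<tau> i))"
proof -
  \<comment> \<open>\<open>P\<close> and \<open>Q\<close> are the invariants of a dependent choice
    of times at which the columns \<open>x n\<close> are touched. The guards make them vacuous past
    the end of the chain, since the choice produces an infinite sequence.\<close>
  define P where "P n \<tau> \<longleftrightarrow>
    (n \<le> k \<longrightarrow> (x n, \<tau>) \<in> G \<and> u 0 \<le> \<tau> \<and> \<tau> \<le> u n \<and> (n > 0 \<longrightarrow> x k \<sqsubset> acc \<tau>))" for n \<tau>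
  define Q where "Q n \<tau> \<tau>' \<longleftrightarrow>
    (n < k \<longrightarrow> \<tau> < \<tau>' \<and> (n > 0 \<longrightarrow> acc \<tau>' \<sqsubset> acc \<tau>))" for n \<tau> \<tau>'
  have x_le: "x i \<sqsubseteq> x j" if "i \<le> j" "j \<le> k" for i j
    using chain[of i j] that by (cases "i = j") auto
  have u_le: "u i \<le> u j" if "i \<le> j" "j \<le> k" for i j
    using chain[of i j] that by (cases "i = j") auto
  have "\<exists>f. \<forall>n. P n (f n) \<and> Q n (f n) (f (Suc n))"
  proof (rule dependent_nat_choice)
    show "\<exists>\<tau>. P 0 \<tau>" using G[of 0] by (auto simp: P_def)
    fix \<tau> n assume P: "P n \<tau>"
    show "\<exists>\<tau>'. P (Suc n) \<tau>' \<and> Q n \<tau> \<tau>'"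
    proof (cases "n < k")
      case True
      then have \<tau>: "(x n, \<tau>) \<in> G" "u 0 \<le> \<tau>" "\<tau> \<le> u n" "n > 0 \<Longrightarrow> x k \<sqsubset> acc \<tau>"
        using P by (auto simp: P_def)
      have step: "x n \<sqsubset> x (Suc n)" "u n < u (Suc n)" using chain[of n "Suc n"] True by auto
      obtain \<tau>' where \<tau>': "\<tau> < \<tau>'" "\<tau>' \<le> u (Suc n)" "(x (Suc n), \<tau>') \<in> G"
        and free: "\<And>c. (c, \<tau>) \<in> G \<Longrightarrow> c \<noteq> x (Suc n) \<Longrightarrow>
          \<not> (acc \<tau>' \<sqsubseteq> c \<and> c \<sqsubseteq> x (Suc n)) \<and> \<not> (x (Suc n) \<sqsubseteq> c \<and> c \<sqsubseteq> acc \<tau>')"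
      proof (rule first_touch[of "x (Suc n)" "u (Suc n)" \<tau>])
        show "(x (Suc n), u (Suc n)) \<in> G" using G[of "Suc n"] True by simp
        show "\<tau> < u (Suc n)" using \<tau>(3) step(2) by linarith
      qed (rule that)
      \<comment> \<open>Otherwise \<open>x n\<close>, touched at time \<open>\<tau>\<close>, would
        lie between the access and \<open>x (Suc n)\<close>. So the access is right of
        \<open>x 0\<close>, and since the box contains no access, it is right of
        \<open>x k\<close>.\<close>
      have "\<not> acc \<tau>' \<sqsubseteq> x n" using free[OF \<tau>(1)] step(1) less_imp_le less_imp_neq by blast
      then have "x 0 \<sqsubseteq> acc \<tau>'" using x_le[of 0 n] True by (metis le_cases order_trans zero_le less_imp_le_nat)
      then have right: "x k \<sqsubset> acc \<tau>'"
        using box[of \<tau>'] access[OF \<tau>'(3)] \<tau>' \<tau>(2) u_le[of "Suc n" k] True by force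
      have "acc \<tau>' \<sqsubset> acc \<tau>" if "n > 0"
      proof -
        have "x (Suc n) \<sqsubset> acc \<tau>"
          using le_less_trans[OF x_le[of "Suc n" k] \<tau>(4)[OF that]] True by simp
        then have "acc \<tau> \<noteq> x (Suc n)" "x (Suc n) \<sqsubseteq> acc \<tau>" by auto
        \<comment> \<open>The previous access is itself a touched key at time \<open>\<tau>\<close>,
          to the right of \<open>x (Suc n)\<close>, so the new access cannot reach it.\<close>
        then have "\<not> acc \<tau> \<sqsubseteq> acc \<tau>'" using free[OF access[OF \<tau>(1)]] by blast
        then show ?thesis by (simp add: not_le)
      qed
      then show ?thesis
        using \<tau>' \<tau>(2) right True by (auto simp: P_def Q_def intro!: exI[of _ \<tau>'])
    qed (auto simp: P_def Q_def)
  qed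
  then obtain f where f: "\<And>n. P n (f n)" "\<And>n. Q n (f n) (f (Suc n))" by blast
  \<comment> \<open>The time \<open>f 0 = u 0\<close> only starts the construction; nothing places
    its access to the right of the box. Hence \<open>k + 1\<close> chain points give
    \<open>k\<close> accesses.\<close>
  have "f (Suc i) < f (Suc j) \<and> acc (f (Suc j)) \<sqsubset> acc (f (Suc i))" if "i < j" "j < k" for i j
    using that
  proof (induction j)
    case (Suc j)
    have "f (Suc j) < f (Suc (Suc j)) \<and> acc (f (Suc (Suc j))) \<sqsubset> acc (f (Suc j))"
      using f(2)[of "Suc j"] Suc.prems by (auto simp: Q_def)
    then show ?case using Suc by (cases "i = j") auto
  qed simp
  moreover have "(acc (f (Suc i)), f (Suc i)) \<in> G" if "i < k" for i
    using f(1)[of "Suc i"] that access by (auto simp: P_def)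
  ultimately show ?thesis by (intro exI[of _ "\<lambda>i. f (Suc i)"]) auto
qed

text \<open>Monotonicity of \<open>\<phi>\<close> is stated for the order of the locale, so that a
  reversed labelling can be used with the reversed order. The descent comes either from the
  antidiagonal blocks, if every block captures an access, or from the diagonal of a block that
  captures none.\<close>

lemma descent_of_grid_minor:
  fixes \<phi> :: "'a \<Rightarrow> nat" and \<psi> :: "int \<Rightarrow> nat"
  assumes \<phi>: "\<And>a b. a \<sqsubseteq> b \<Longrightarrow> \<phi> a \<le> \<phi> b" and \<psi>: "\<And>s t. s \<le> t \<Longrightarrow> \<psi> s \<le> \<psi> t"
    and minor: "\<And>i j. i < k * Suc k \<Longrightarrow> j < k * Suc k \<Longrightarrow> \<exists>x t. (x, t) \<in> G \<and> \<phi> x = i \<and> \<psi> t = j"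
  shows "\<exists>\<tau>. (\<forall>i<k. (acc (\<tau> i), \<tau> i) \<in> G) \<and>
    (\<forall>i j. i < j \<longrightarrow> j < k \<longrightarrow> \<tau> i < \<tau> j \<and> acc (\<tau> j) \<sqsubset> acc (\<tau> i))"
proof -
  define captured where "captured I J t \<longleftrightarrow>
    (acc t, t) \<in> G \<and> \<phi> (acc t) div Suc k = I \<and> \<psi> t div Suc k = J" for I J t
  have \<phi>_less: "a \<sqsubset> b" if "\<phi> a < \<phi> b" for a b using \<phi>[of b a] that by force
  have \<psi>_less: "s < t" if "\<psi> s < \<psi> t" for s t using \<psi>[of t s] that by force
  show ?thesis
  proof (cases "\<forall>I<k. \<forall>J<k. \<exists>t. captured I J t")
    case True
    \<comment> \<open>On the antidiagonal later accesses have smaller keys.\<close>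
    then have "\<forall>i<k. \<exists>t. captured (k - 1 - i) i t" by simp
    then obtain \<tau> where \<tau>: "\<And>i. i < k \<Longrightarrow> captured (k - 1 - i) i (\<tau> i)" by metis
    have "\<tau> i < \<tau> j \<and> acc (\<tau> j) \<sqsubset> acc (\<tau> i)" if "i < j" "j < k" for i j
    proof
      have "\<psi> (\<tau> i) div Suc k < \<psi> (\<tau> j) div Suc k"
        using \<tau>[of i] \<tau>[of j] that by (simp add: captured_def)
      then show "\<tau> i < \<tau> j" by (rule \<psi>_less[OF div_less_div_imp_less])
      have "\<phi> (acc (\<tau> j)) div Suc k < \<phi> (acc (\<tau> i)) div Suc k"
        using \<tau>[of i] \<tau>[of j] that by (simp add: captured_def)
      then show "acc (\<tau> j) \<sqsubset> acc (\<tau> i)" by (rule \<phi>_less[OF div_less_div_imp_less])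
    qed
    then show ?thesis using \<tau> by (auto simp: captured_def)
  next
    case False
    then obtain I J where IJ: "I < k" "J < k" "\<And>t. \<not> captured I J t" by blast
    have lt: "I' * Suc k + i < k * Suc k" if "I' < k" "i \<le> k" for I' i
    proof -
      have "I' * Suc k + i < Suc I' * Suc k" using that by simp
      also have "\<dots> \<le> k * Suc k" using that by (intro mult_le_mono) auto
      finally show ?thesis .
    qed
    \<comment> \<open>The diagonal of the uncaptured block is an increasing chain of
      \<open>k + 1\<close> points. An access in its bounding box would, by monotonicity of the
      labels, belong to the block.\<close>
    have "\<exists>p. p \<in> G \<and> \<phi> (fst p) = I * Suc k + i \<and> \<psi> (snd p) = J * Suc k + i" if "i \<le> k" for i
      using minor[OF lt[OF IJ(1) that] lt[OF IJ(2) that]] by force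
    then obtain p where p: "\<And>i. i \<le> k \<Longrightarrow>
        p i \<in> G \<and> \<phi> (fst (p i)) = I * Suc k + i \<and> \<psi> (snd (p i)) = J * Suc k + i"
      by metis
    have block: "v div Suc k = I'" if "I' * Suc k + 0 \<le> v" "v \<le> I' * Suc k + k" for v I'
      using that by (intro div_nat_eqI) (auto simp: algebra_simps)
    show ?thesis
    proof (rule descent_of_uncaptured_chain[of k "\<lambda>i. fst (p i)" "\<lambda>i. snd (p i)"])
      show "(fst (p i), snd (p i)) \<in> G" if "i \<le> k" for i using p[OF that] by simp
      show "fst (p i) \<sqsubset> fst (p j) \<and> snd (p i) < snd (p j)" if "i < j" "j \<le> k" for i j
        using p[of i] p[of j] that by (auto intro!: \<phi>_less \<psi>_less)
      fix t assume t: "(acc t, t) \<in> G" "snd (p 0) \<le> t" "t \<le> snd (p k)"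
      show "\<not> (fst (p 0) \<sqsubseteq> acc t \<and> acc t \<sqsubseteq> fst (p k))"
      proof
        assume "fst (p 0) \<sqsubseteq> acc t \<and> acc t \<sqsubseteq> fst (p k)"
        then have "\<phi> (acc t) div Suc k = I"
          using \<phi>[of "fst (p 0)" "acc t"] \<phi>[of "acc t" "fst (p k)"] p[of 0] p[of k]
          by (intro block) simp_all
        moreover have "\<psi> t div Suc k = J"
          using \<psi>[OF t(2)] \<psi>[OF t(3)] p[of 0] p[of k]
          by (intro block) simp_all
        ultimately show False using IJ(3)[of t] t(1) by (simp add: captured_def)
      qed
    qed
  qed
qed

end

section \<open>The output of Greedy\<close>

lemma mem_greedy_upto_iff:
  "(b, t) \<in> greedy_upto T X m \<longleftrightarrow> (\<exists>i<m. t = int (Suc i) \<and>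
     (b, t) \<in> greedy_step (tree_points T \<union> greedy_upto T X i) (X ! i) (int (Suc i)))"
proof (induction m)
  case (Suc m)
  have "(b, t) \<in> greedy_step P a s \<Longrightarrow> t = s" for P a s
    by (auto simp: greedy_step_def)
  then show ?case using Suc by (auto simp: less_Suc_eq)
qed simp

lemma last_time_eq_SomeD:
  assumes "finite P" "last_time P b t = Some \<tau>"
  shows "(b, \<tau>) \<in> P" "\<tau> \<le> t"
proof -
  let ?S = "{s. s \<le> t \<and> (b, s) \<in> P}"
  have "finite ?S" by (rule finite_subset[of _ "snd ` P"]) (use assms in force)+
  moreover have "?S \<noteq> {}" "\<tau> = Max ?S"
    using assms(2) by (auto simp: last_time_def split: if_splits)
  ultimately have "\<tau> \<in> ?S" using Max_in by blast
  then show "(b, \<tau>) \<in> P" "\<tau> \<le> t" by auto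
qed

lemma greedy_upto_subset:
  assumes "set_tree T \<subseteq> S" "set X \<subseteq> S" "m \<le> length X"
  shows "greedy_upto T X m \<subseteq> S \<times> {1..int m}"
  using assms(3)
proof (induction m)
  case (Suc m)
  let ?P = "tree_points T \<union> greedy_upto T X m"
  have P: "fst ` ?P \<subseteq> S" using Suc assms(1) by (force simp: tree_points_def)
  have "X ! m \<in> S" using Suc.prems assms(2) by (auto simp: Suc_le_eq)
  moreover have "b \<in> S" if "last_time ?P b t = Some \<tau>" for b t \<tau>
    using last_time_eq_SomeD(1)[OF _ that] P finite_tree_points finite_greedy_upto by force
  ultimately have "greedy_step ?P (X ! m) (int (Suc m)) \<subseteq> S \<times> {1..int (Suc m)}"
    by (auto simp: greedy_step_def)
  moreover have "greedy_upto T X m \<subseteq> S \<times> {1..int (Suc m)}" using Suc by force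
  ultimately show ?case by simp
qed simp

lemma greedy_access:
  assumes "(b, t) \<in> greedy T X"
  shows "(X ! (nat (t - 1)), t) \<in> greedy T X"
  using assms unfolding greedy_def mem_greedy_upto_iff by (auto simp: greedy_step_def)

text \<open>The rectangle that admits \<open>(b, t)\<close> excludes \<open>(c, s)\<close>, so the
  last touch \<open>\<tau>\<close> of \<open>b\<close> is after \<open>s\<close>. Since
  \<open>s \<ge> 1\<close>, this is later than every tree point, so \<open>(b, \<tau>)\<close> is an
  output point: the output alone satisfies \<open>touch\<close>, whatever the initial tree.\<close>

lemma greedy_touch:
  assumes "(b, t) \<in> greedy T X" "(c, s) \<in> greedy T X" "s < t" "c \<noteq> b"
    and between: "X ! (nat (t - 1)) \<le> c \<and> c \<le> b \<or> b \<le> c \<and> c \<le> X ! (nat (t - 1))"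
  shows "\<exists>s'>s. s' < t \<and> (b, s') \<in> greedy T X"
proof -
  obtain i where i: "i < length X" "t = int (Suc i)"
    and b: "(b, t) \<in> greedy_step (tree_points T \<union> greedy_upto T X i) (X ! i) (int (Suc i))"
    using assms(1) unfolding greedy_def mem_greedy_upto_iff by blast
  let ?P = "tree_points T \<union> greedy_upto T X i"
  have c: "(c, s) \<in> ?P" and "s \<ge> 1"
    using assms(2,3) i unfolding greedy_def by (auto simp: mem_greedy_upto_iff)
  have "b \<noteq> X ! i" using between \<open>c \<noteq> b\<close> i by auto
  then obtain \<tau> where \<tau>: "last_time ?P b (t - 1) = Some \<tau>"
    "rectangle (X ! i, t) (b, \<tau>) \<inter> ?P \<subseteq> {(b, \<tau>)}"
    using b i by (auto simp: greedy_step_def)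
  have b\<tau>: "(b, \<tau>) \<in> ?P" "\<tau> < t"
    using last_time_eq_SomeD[OF _ \<tau>(1)] finite_tree_points finite_greedy_upto by auto
  have "(c, s) \<notin> rectangle (X ! i, t) (b, \<tau>)" using \<tau>(2) c \<open>c \<noteq> b\<close> by auto
  then have "s < \<tau>"
    using between i \<open>s < t\<close> b\<tau>(2) by (auto simp: rectangle_def)
  then have "(b, \<tau>) \<in> greedy_upto T X i"
    using b\<tau>(1) \<open>s \<ge> 1\<close> by (auto simp: tree_points_def)
  then have "(b, \<tau>) \<in> greedy T X"
    using i(1) unfolding greedy_def mem_greedy_upto_iff by force
  then show ?thesis using \<open>s < \<tau>\<close> b\<tau>(2) by blast
qed

section \<open>Pattern containment and the bound on the cost\<close>

lemma subseq_map_nth: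
  assumes "m \<le> length X" "\<And>i. i < k \<Longrightarrow> f i < m" "\<And>i j. i < j \<Longrightarrow> j < k \<Longrightarrow> f i < f j"
  shows "subseq (map (\<lambda>i. X ! f i) [0..<k]) (take m X)"
  using assms
proof (induction k arbitrary: m)
  case (Suc k)
  \<comment> \<open>The list is cut at the last index \<open>f k\<close>, which bounds all earlier
    ones; this is why the length \<open>m\<close> of the prefix varies in the induction.\<close>
  have "subseq (map (\<lambda>i. X ! f i) [0..<k]) (take (f k) X)"
    using Suc.prems(1) Suc.prems(2)[of k] Suc.prems(3) by (intro Suc.IH) auto
  then have "subseq (map (\<lambda>i. X ! f i) [0..<k] @ [X ! f k]) (take (f k) X @ [X ! f k])"
    by (intro list_emb_append_mono) auto
  also have "take (f k) X @ [X ! f k] = take (Suc (f k)) X"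
    using Suc.prems(1) Suc.prems(2)[of k] by (simp add: take_Suc_conv_app_nth)
  also have "subseq \<dots> (take m X)"
  proof -
    have "prefix (take (Suc (f k)) (take m X)) (take m X)" by (rule take_is_prefix)
    then show ?thesis using Suc.prems(2)[of k] by (auto simp: min_def intro: prefix_imp_subseq)
  qed
  finally show ?case by simp
qed simp

lemma contains_patternI:
  assumes "length p = k" "\<And>i. i < k \<Longrightarrow> f i < length X" "\<And>i j. i < j \<Longrightarrow> j < k \<Longrightarrow> f i < f j"
    and "\<And>i j. i < k \<Longrightarrow> j < k \<Longrightarrow> X ! f i < X ! f j \<longleftrightarrow> p ! i < p ! j"
  shows "contains_pattern X p"
  unfolding contains_pattern_def order_isomorphic_def
  using assms subseq_map_nth[of "length X" X k f]
  by (intro exI[of _ "map (\<lambda>i. X ! f i) [0..<k]"]) auto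

lemma card_greedy_le:
  assumes X: "X \<in> permutations_of_set {1..n}" and T: "bst_on n T"
    and avoid: "k_increasing k X \<or> k_decreasing k X"
  shows "card (greedy T X) \<le> 2 ^ (10 * (k * Suc k)) * n"
proof -
  define K where "K = k * Suc k"
  define acc where "acc t = X ! (nat (t - 1))" for t
  have X': "set X = {1..n}" "length X = n"
    using X by (auto simp: permutations_of_set_def distinct_card[symmetric])
  have sub: "greedy T X \<subseteq> {1..n} \<times> {1..int n}"
    using greedy_upto_subset[of T "{1..n}" X n] T X' by (simp add: greedy_def bst_on_def)
  \<comment> \<open>For \<open>k = 0\<close> both patterns are empty and contained in every
    list.\<close>
  have "k > 0"
  proof (rule ccontr)
    assume "\<not> k > 0"
    then have "contains_pattern X (rev [1..<Suc k])" "contains_pattern X [1..<Suc k]"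
      by (auto intro: contains_patternI[of _ 0])
    then show False using avoid by (simp add: k_increasing_def k_decreasing_def avoids_pattern_def)
  qed
  have "\<not> grid_minor K K (greedy T X)"
  proof
    assume "grid_minor K K (greedy T X)"
    then obtain \<phi> \<psi> where \<phi>: "mono \<phi>" and \<psi>: "mono \<psi>"
      and minor: "\<And>i j. i < K \<Longrightarrow> j < K \<Longrightarrow> \<exists>x t. (x, t) \<in> greedy T X \<and> \<phi> x = i \<and> \<psi> t = j"
      using grid_minorE by metis
    \<comment> \<open>The bound \<open>r \<ge> 1\<close> keeps the conversion of times to list
      indices strictly increasing.\<close>
    have index: "nat (r - 1) < length X" "r \<ge> 1" if "(a, r) \<in> greedy T X" for a r
      using subsetD[OF sub that] X'(2) by auto
    show False
      using avoid
    proof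
      assume "k_increasing k X"
      interpret H: greedy_history "(\<le>)" "(<)" "greedy T X" acc
        by unfold_locales (use greedy_access greedy_touch in \<open>auto simp: acc_def\<close>)
      obtain \<tau> where \<tau>: "\<And>i. i < k \<Longrightarrow> (acc (\<tau> i), \<tau> i) \<in> greedy T X"
          "\<And>i j. i < j \<Longrightarrow> j < k \<Longrightarrow> \<tau> i < \<tau> j \<and> acc (\<tau> j) < acc (\<tau> i)"
        using H.descent_of_grid_minor[OF monoD[OF \<phi>] monoD[OF \<psi>] minor[unfolded K_def]] by blast
      have "contains_pattern X (rev [1..<Suc k])"
      proof (rule contains_patternI[of _ k "\<lambda>i. nat (\<tau> i - 1)"])
        show "nat (\<tau> i - 1) < nat (\<tau> j - 1)" if "i < j" "j < k" for i j
          using \<tau>(2)[OF that] index(2)[OF \<tau>(1)[of i]] that by simp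
        show "X ! (nat (\<tau> i - 1)) < X ! (nat (\<tau> j - 1)) \<longleftrightarrow> rev [1..<Suc k] ! i < rev [1..<Suc k] ! j"
          if "i < k" "j < k" for i j
          using \<tau>(2)[of i j] \<tau>(2)[of j i] that
          by (cases i j rule: linorder_cases) (auto simp: acc_def rev_nth simp del: upt_Suc)
      qed (use index(1)[OF \<tau>(1)] in auto)
      then show False
        using \<open>k_increasing k X\<close> by (simp add: k_increasing_def avoids_pattern_def)
    next
      assume "k_decreasing k X"
      \<comment> \<open>The conditions on the history treat both sides of a column alike, so they
        hold for the reversed order, where a descent is an ascent of the keys.\<close>
      interpret H: greedy_history "(\<ge>)" "(>)" "greedy T X" acc
        by unfold_locales (use greedy_access greedy_touch in \<open>auto simp: acc_def\<close>)
      \<comment> \<open>Truncated subtraction sends labels from \<open>K\<close> on to 0, which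
        still reverses the order and permutes the labels below \<open>K\<close>.\<close>
      have anti: "K - 1 - \<phi> a \<le> K - 1 - \<phi> b" if "b \<le> a" for a b
        using monoD[OF \<phi> that] by simp
      have minor': "\<exists>x t. (x, t) \<in> greedy T X \<and> K - 1 - \<phi> x = i \<and> \<psi> t = j" if "i < K" "j < K" for i j
        using minor[of "K - 1 - i" j] that by force
      obtain \<tau> where \<tau>: "\<And>i. i < k \<Longrightarrow> (acc (\<tau> i), \<tau> i) \<in> greedy T X"
          "\<And>i j. i < j \<Longrightarrow> j < k \<Longrightarrow> \<tau> i < \<tau> j \<and> acc (\<tau> i) < acc (\<tau> j)"
        using H.descent_of_grid_minor[of "\<lambda>x. K - 1 - \<phi> x" \<psi> k, OF anti monoD[OF \<psi>]] minor'
        unfolding K_def by blast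
      have "contains_pattern X [1..<Suc k]"
      proof (rule contains_patternI[of _ k "\<lambda>i. nat (\<tau> i - 1)"])
        show "nat (\<tau> i - 1) < nat (\<tau> j - 1)" if "i < j" "j < k" for i j
          using \<tau>(2)[OF that] index(2)[OF \<tau>(1)[of i]] that by simp
        show "X ! (nat (\<tau> i - 1)) < X ! (nat (\<tau> j - 1)) \<longleftrightarrow> [1..<Suc k] ! i < [1..<Suc k] ! j"
          if "i < k" "j < k" for i j
          using \<tau>(2)[of i j] \<tau>(2)[of j i] that
          by (cases i j rule: linorder_cases) (auto simp: acc_def simp del: upt_Suc)
      qed (use index(1)[OF \<tau>(1)] in auto)
      then show False
        using \<open>k_decreasing k X\<close> by (simp add: k_decreasing_def avoids_pattern_def)
    qed
  qed
  \<comment> \<open>Keys and times start at 1, so the shift to coordinates below \<open>n\<close> is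
    injective on the output and preserves its cardinality.\<close>
  moreover define A where "A = map_prod (\<lambda>x. x - 1) (\<lambda>t. nat (t - 1)) ` greedy T X"
  have "mono (\<lambda>x::nat. x - 1)" "mono (\<lambda>t. nat (t - 1))"
    by (auto simp: mono_def intro!: diff_le_mono nat_mono)
  ultimately have "\<not> grid_minor K K A"
    using grid_minor_image unfolding A_def by blast
  moreover have "A \<subseteq> {..<n} \<times> {..<n}" using sub unfolding A_def by force
  moreover have "K > 0" using \<open>k > 0\<close> by (simp add: K_def)
  ultimately have "card A \<le> 2 ^ (10 * K) * n" by (intro card_no_grid_minor)
  moreover have "inj_on (map_prod (\<lambda>x. x - 1) (\<lambda>t. nat (t - 1))) ({1..n} \<times> {1..int n})"
    by (auto simp: inj_on_def)
  then have "card A = card (greedy T X)"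
    unfolding A_def using sub by (intro card_image) (rule inj_on_subset)
  ultimately show ?thesis by (simp add: K_def)
qed

theorem mainTheorem6:
  "\<exists>f :: nat \<Rightarrow> real. f \<in> O(\<lambda>k. (real k)\<^sup>2) \<and>
     (\<forall>n k X T. X \<in> permutations_of_set {1..n} \<longrightarrow>
        k_increasing k X \<or> k_decreasing k X \<longrightarrow>
        bst_on n T \<longrightarrow>
        real (card (greedy T X)) \<le> real n * 2 powr f k)"
proof (intro exI conjI allI impI)
  \<comment> \<open>The exponent is \<open>10 * K\<close> for the minor size
    \<open>K = k * Suc k\<close>; since \<open>k * Suc k \<le> 2 * k\<^sup>2\<close>, the constant
    20 works below for every \<open>k\<close>.\<close>
  define f :: "nat \<Rightarrow> real" where "f k = real (10 * (k * Suc k))" for k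
  show "f \<in> O(\<lambda>k. (real k)\<^sup>2)"
  proof (rule bigoI[of _ 20], rule always_eventually, rule allI)
    fix k
    have "k * Suc k \<le> 2 * k\<^sup>2" by (cases k) (auto simp: power2_eq_square)
    then have "real (10 * (k * Suc k)) \<le> real (20 * k\<^sup>2)" by (intro of_nat_mono) simp
    then show "norm (f k) \<le> 20 * norm ((real k)\<^sup>2)" by (simp add: f_def)
  qed
  fix n k X T
  assume "X \<in> permutations_of_set {1..n}" "k_increasing k X \<or> k_decreasing k X" "bst_on n T"
  then have "real (card (greedy T X)) \<le> real (2 ^ (10 * (k * Suc k)) * n)"
    by (intro of_nat_mono card_greedy_le)
  also have "\<dots> = real n * 2 powr f k"
    unfolding f_def by (subst powr_realpow) auto
  finally show "real (card (greedy T X)) \<le> real n * 2 powr f k" .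
qed

end
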